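(* Let $X$ be a chain. (a) Let $S\in\{\mathcal{PO}(X),\mathcal{POI}(X)\}$ and $\alpha,\beta\in S$. Then $\alpha\,\mathcal{J}\,\beta$ in $S$ if and only if there exist order-preserving injections $\theta:\mathrm{Im}(\alpha)\to\mathrm{Im}(\beta)$ and $\tau:\mathrm{Im}(\beta)\to\mathrm{Im}(\alpha)$. (b) Let $S\in\{\mathcal{POP}(X),\mathcal{POPI}(X)\}$ and $\alpha,\beta\in S$. Then $\alpha\,\mathcal{J}\,\beta$ in $S$ if and only if there exist orientation-preserving injections $\theta:\mathrm{Im}(\alpha)\to\mathrm{Im}(\beta)$ and $\tau:\mathrm{Im}(\beta)\to\mathrm{Im}(\alpha)$.
   Context: $X$ is a chain (totally ordered set), finite or infinite. $\mathcal{PT}(X)$ is the monoid of all partial transformations of $X$ (including the empty one) under composition of partial maps, written on the right: $x(\alpha\beta)=(x\alpha)\beta$, with $\mathrm{Dom}(\alpha\beta)=\{x\in\mathrm{Dom}(\alpha)\mid x\alpha\in\mathrm{Dom}(\beta)\}$. $\alpha\in\mathcal{PT}(X)$ is order-preserving on $Y\subseteq\mathrm{Dom}(\alpha)$ if $x\le y$ implies $x\alpha\le y\alpha$ for all $x,y\in Y$, and order-preserving if it is so on $\mathrm{Dom}(\alpha)$. $\alpha\in\mathcal{PT}(X)$ is orientation-preserving if it is the empty transformation or there exists a non-empty subset $Y$ of $\mathrm{Dom}(\alpha)$ such that: (OP1) $\alpha$ is order-preserving both on $Y$ and on $\mathrm{Dom}(\alpha)\setminus Y$; (OP2) for all $a\in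 Y$ and $b\in\mathrm{Dom}(\alpha)\setminus Y$, $a\le b$ and $a\alpha\ge b\alpha$. A map between subsets of $X$ is regarded as an element of $\mathcal{PT}(X)$ when calling it order-preserving or orientation-preserving. $\mathcal{PO}(X)$ and $\mathcal{POP}(X)$ are the submonoids of $\mathcal{PT}(X)$ of all order-preserving, respectively orientation-preserving, partial transformations; $\mathcal{POI}(X)$ and $\mathcal{POPI}(X)$ are their respective submonoids of injective elements. Green's relation $\mathcal{J}$ on a monoid $S$: $\alpha\,\mathcal{J}\,\beta$ iff $S\alpha S=S\beta S$. *)

theory Defs
  imports "HOL-Algebra.Coset"
begin

text \<open>A chain is a set X of elements of a linearly ordered type, with the induced order; this
  includes the empty chain. Partial transformations of X are maps with domain and range in X.\<close>

text \<open>Products are written for maps acting on the right: the product of f and g applies f first,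
  whereas \<open>\<circ>\<^sub>m\<close> applies its right operand first.\<close>

definition PT :: "'a set \<Rightarrow> ('a \<rightharpoonup> 'a) monoid" where
  "PT X = \<lparr>carrier = {\<alpha>. dom \<alpha> \<subseteq> X \<and> ran \<alpha> \<subseteq> X},
           monoid.mult = (\<lambda>\<alpha> \<beta>. \<beta> \<circ>\<^sub>m \<alpha>),
           one = Some |` X\<rparr>"

text \<open>To be used for subsets Y of the domain only, where \<open>the (\<alpha> x)\<close> is the value at x.\<close>

definition order_preserving_on :: "'a::linorder set \<Rightarrow> ('a \<rightharpoonup> 'a) \<Rightarrow> bool" where
  "order_preserving_on Y \<alpha> \<longleftrightarrow> mono_on Y (\<lambda>x. the (\<alpha> x))"

definition order_preserving :: "('a::linorder \<rightharpoonup> 'a) \<Rightarrow> bool" where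
  "order_preserving \<alpha> \<longleftrightarrow> order_preserving_on (dom \<alpha>) \<alpha>"

definition orientation_preserving :: "('a::linorder \<rightharpoonup> 'a) \<Rightarrow> bool" where
  "orientation_preserving \<alpha> \<longleftrightarrow> \<alpha> = Map.empty \<or>
     (\<exists>Y. Y \<noteq> {} \<and> Y \<subseteq> dom \<alpha> \<and>
        order_preserving_on Y \<alpha> \<and> order_preserving_on (dom \<alpha> - Y) \<alpha> \<and>
        (\<forall>a\<in>Y. \<forall>b\<in>dom \<alpha> - Y. a \<le> b \<and> the (\<alpha> a) \<ge> the (\<alpha> b)))"

definition pinjective :: "('a \<rightharpoonup> 'a) \<Rightarrow> bool" where
  "pinjective \<alpha> \<longleftrightarrow> inj_on \<alpha> (dom \<alpha>)"

definition PO :: "'a::linorder set \<Rightarrow> ('a \<rightharpoonup> 'a) monoid" where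
  "PO X = (PT X)\<lparr>carrier := {\<alpha> \<in> carrier (PT X). order_preserving \<alpha>}\<rparr>"

definition POP :: "'a::linorder set \<Rightarrow> ('a \<rightharpoonup> 'a) monoid" where
  "POP X = (PT X)\<lparr>carrier := {\<alpha> \<in> carrier (PT X). orientation_preserving \<alpha>}\<rparr>"

definition POI :: "'a::linorder set \<Rightarrow> ('a \<rightharpoonup> 'a) monoid" where
  "POI X = (PO X)\<lparr>carrier := {\<alpha> \<in> carrier (PO X). pinjective \<alpha>}\<rparr>"

definition POPI :: "'a::linorder set \<Rightarrow> ('a \<rightharpoonup> 'a) monoid" where
  "POPI X = (POP X)\<lparr>carrier := {\<alpha> \<in> carrier (POP X). pinjective \<alpha>}\<rparr>"

definition green_J :: "('m, 'r) monoid_scheme \<Rightarrow> 'm \<Rightarrow> 'm \<Rightarrow> bool" where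
  "green_J S a b \<longleftrightarrow>
     (carrier S #>\<^bsub>S\<^esub> a) <#>\<^bsub>S\<^esub> carrier S = (carrier S #>\<^bsub>S\<^esub> b) <#>\<^bsub>S\<^esub> carrier S"

text \<open>A total injection from A to B, regarded as a partial transformation with domain A.\<close>

definition injection_between :: "'a set \<Rightarrow> 'a set \<Rightarrow> ('a \<rightharpoonup> 'a) \<Rightarrow> bool" where
  "injection_between A B \<theta> \<longleftrightarrow> dom \<theta> = A \<and> ran \<theta> \<subseteq> B \<and> pinjective \<theta>"

end

theory Submission
  imports Defs
begin

text \<open>Write products from left to right. Membership of \<open>\<alpha>\<close> in the ideal generated by \<open>\<beta>\<close> means
  \<open>\<alpha> = \<gamma> \<beta> \<delta>\<close>. Such a factorization gives a map from the image of \<open>\<alpha>\<close> to the image of \<open>\<beta>\<close>: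
  choose, for each value \<open>y\<close> of \<open>\<alpha>\<close>, a value \<open>z\<close> of \<open>\<beta>\<close> with \<open>z \<delta> = y\<close>. This is a section of
  \<open>\<delta>\<close>, that is, a partial right inverse, and sections are always injective. Conversely, given an
  injection \<open>\<theta>\<close> from the image of \<open>\<alpha>\<close> to the image of \<open>\<beta>\<close>, choose a section \<open>\<sigma>\<close> of \<open>\<beta>\<close>; then
  \<open>\<alpha> = (\<alpha> \<theta> \<sigma>) \<beta> \<theta>\<^sup>-\<^sup>1\<close>, and \<open>\<theta>\<^sup>-\<^sup>1\<close> is a section of \<open>\<theta>\<close>.

  So the result holds for every class of partial maps that contains the partial identities and is
  closed under composition and under passing to sections. The four monoids come from such classes:
  a section of an order-preserving map is order-preserving because the order is total, a section
  of an orientation-preserving map is orientation-preserving because reversing the roles of domain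
  and image swaps the two pieces of the domain, and injectivity is automatic for sections. The one
  point that needs a case distinction is that orientation-preserving maps compose
  (\<open>orientation_preserving_comp\<close>).\<close>

section \<open>Sections of partial maps\<close>

definition partial_section :: "('a \<rightharpoonup> 'b) \<Rightarrow> ('b \<rightharpoonup> 'a) \<Rightarrow> bool" where
  "partial_section f g \<longleftrightarrow> (\<forall>y x. g y = Some x \<longrightarrow> f x = Some y)"

lemma partial_sectionD: "partial_section f g \<Longrightarrow> g y = Some x \<Longrightarrow> f x = Some y"
  by (simp add: partial_section_def)

lemma partial_section_exists:
  assumes "\<forall>y\<in>B. \<exists>x\<in>A. f x = Some y"
  obtains g where "dom g = B" "ran g \<subseteq> A" "partial_section f g"
proof -
  obtain s where s: "\<forall>y\<in>B. s y \<in> A \<and> f (s y) = Some y"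
    using assms by metis
  show thesis
  proof
    show "dom (\<lambda>y. if y \<in> B then Some (s y) else None) = B"
      by (auto split: if_splits)
    show "ran (\<lambda>y. if y \<in> B then Some (s y) else None) \<subseteq> A"
      using s by (auto simp: ran_def split: if_splits)
    show "partial_section f (\<lambda>y. if y \<in> B then Some (s y) else None)"
      using s by (auto simp: partial_section_def split: if_splits)
  qed
qed

lemma pinjective_iff:
  "pinjective f \<longleftrightarrow> (\<forall>x y z. f x = Some z \<longrightarrow> f y = Some z \<longrightarrow> x = y)"
  unfolding pinjective_def inj_on_def dom_def by fastforce

lemma pinjective_section: "partial_section f g \<Longrightarrow> pinjective g"
  unfolding pinjective_iff partial_section_def by (metis option.inject)

lemma pinjective_comp: "pinjective f \<Longrightarrow> pinjective g \<Longrightarrow> pinjective (g \<circ>\<^sub>m f)"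
  unfolding pinjective_iff map_comp_Some_iff by blast

lemma pinjective_identity: "pinjective (Some |` X)"
  by (auto simp: pinjective_iff restrict_map_def split: if_splits)

section \<open>Green's J relation in monoids of partial maps\<close>

lemma green_J_iff_factorization:
  assumes "monoid S" "a \<in> carrier S" "b \<in> carrier S"
  shows "green_J S a b \<longleftrightarrow>
    (\<exists>u\<in>carrier S. \<exists>v\<in>carrier S. a = u \<otimes>\<^bsub>S\<^esub> b \<otimes>\<^bsub>S\<^esub> v) \<and>
    (\<exists>u\<in>carrier S. \<exists>v\<in>carrier S. b = u \<otimes>\<^bsub>S\<^esub> a \<otimes>\<^bsub>S\<^esub> v)"
proof -
  interpret monoid S by fact
  let ?I = "\<lambda>c. (carrier S #>\<^bsub>S\<^esub> c) <#>\<^bsub>S\<^esub> carrier S"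
  have mem: "d \<in> ?I c \<longleftrightarrow> (\<exists>u\<in>carrier S. \<exists>v\<in>carrier S. d = u \<otimes>\<^bsub>S\<^esub> c \<otimes>\<^bsub>S\<^esub> v)" for c d
    by (auto simp: r_coset_def set_mult_def)
  have refl: "c \<in> ?I c" if "c \<in> carrier S" for c
    unfolding mem using that by (intro bexI[of _ "\<one>\<^bsub>S\<^esub>"]) auto
  have sub: "?I c \<subseteq> ?I d" if c: "c \<in> ?I d" and d: "d \<in> carrier S" for c d
  proof
    fix x assume "x \<in> ?I c"
    then obtain u v where uv: "u \<in> carrier S" "v \<in> carrier S" "x = u \<otimes>\<^bsub>S\<^esub> c \<otimes>\<^bsub>S\<^esub> v"
      unfolding mem by blast
    obtain u' v' where uv': "u' \<in> carrier S" "v' \<in> carrier S" "c = u' \<otimes>\<^bsub>S\<^esub> d \<otimes>\<^bsub>S\<^esub> v'"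
      using c unfolding mem by blast
    have "x = (u \<otimes>\<^bsub>S\<^esub> u') \<otimes>\<^bsub>S\<^esub> d \<otimes>\<^bsub>S\<^esub> (v' \<otimes>\<^bsub>S\<^esub> v)"
      using uv uv' d by (simp add: m_assoc)
    then show "x \<in> ?I d" unfolding mem using uv uv' by blast
  qed
  have "green_J S a b \<longleftrightarrow> a \<in> ?I b \<and> b \<in> ?I a"
    unfolding green_J_def using refl sub assms by blast
  then show ?thesis unfolding mem .
qed

definition PT_sub :: "(('a \<rightharpoonup> 'a) \<Rightarrow> bool) \<Rightarrow> 'a set \<Rightarrow> ('a \<rightharpoonup> 'a) monoid" where
  "PT_sub P X = (PT X)\<lparr>carrier := {\<alpha> \<in> carrier (PT X). P \<alpha>}\<rparr>"

lemma PT_sub_simps: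
  "\<alpha> \<in> carrier (PT_sub P X) \<longleftrightarrow> dom \<alpha> \<subseteq> X \<and> ran \<alpha> \<subseteq> X \<and> P \<alpha>"
  "\<alpha> \<otimes>\<^bsub>PT_sub P X\<^esub> \<beta> = \<beta> \<circ>\<^sub>m \<alpha>"
  "\<one>\<^bsub>PT_sub P X\<^esub> = Some |` X"
  by (auto simp: PT_sub_def PT_def)

lemma dom_map_comp_subset: "dom (g \<circ>\<^sub>m f) \<subseteq> dom f"
  by (auto simp: map_comp_Some_iff)

lemma ran_map_comp_subset: "ran (g \<circ>\<^sub>m f) \<subseteq> ran g"
  by (auto simp: ran_def map_comp_Some_iff)

lemma map_comp_assoc': "(h \<circ>\<^sub>m g) \<circ>\<^sub>m f = h \<circ>\<^sub>m (g \<circ>\<^sub>m f)"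
  by (auto simp: map_comp_def fun_eq_iff split: option.splits)

text \<open>Closure under sections supplies all the maps that the argument has to invent: the injection
  between the images, the inverse of a given injection, and the choice of preimages.\<close>

locale section_closed =
  fixes P :: "('a \<rightharpoonup> 'a) \<Rightarrow> bool"
  assumes P_identity: "P (Some |` X)"
    and P_comp: "P f \<Longrightarrow> P g \<Longrightarrow> P (g \<circ>\<^sub>m f)"
    and P_section: "P f \<Longrightarrow> partial_section f g \<Longrightarrow> P g"
begin

lemma monoid_PT_sub: "monoid (PT_sub P X)"
proof (rule monoidI)
  fix f g assume "f \<in> carrier (PT_sub P X)" "g \<in> carrier (PT_sub P X)"
  then show "f \<otimes>\<^bsub>PT_sub P X\<^esub> g \<in> carrier (PT_sub P X)"
    using dom_map_comp_subset[of g f] ran_map_comp_subset[of g f] P_comp[of f g]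
    unfolding PT_sub_simps by blast
next
  show "\<one>\<^bsub>PT_sub P X\<^esub> \<in> carrier (PT_sub P X)"
    using P_identity[of X]
    by (auto simp: PT_sub_simps ran_def restrict_map_def split: if_splits)
next
  fix f assume "f \<in> carrier (PT_sub P X)"
  then have f: "dom f \<subseteq> X" "ran f \<subseteq> X" by (auto simp: PT_sub_simps)
  show "\<one>\<^bsub>PT_sub P X\<^esub> \<otimes>\<^bsub>PT_sub P X\<^esub> f = f"
  proof
    fix x
    have "f x = None" if "x \<notin> X" using f(1) that by blast
    then show "(\<one>\<^bsub>PT_sub P X\<^esub> \<otimes>\<^bsub>PT_sub P X\<^esub> f) x = f x"
      by (simp add: PT_sub_simps map_comp_def restrict_map_def)
  qed
  show "f \<otimes>\<^bsub>PT_sub P X\<^esub> \<one>\<^bsub>PT_sub P X\<^esub> = f"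
    using f(2) by (auto simp: PT_sub_simps map_comp_def restrict_map_def fun_eq_iff ran_def
        split: option.splits)
qed (simp add: PT_sub_simps map_comp_assoc')

lemma injection_of_factorization:
  assumes v: "P v" and eq: "\<alpha> = v \<circ>\<^sub>m (\<beta> \<circ>\<^sub>m u)"
  shows "\<exists>\<theta>. injection_between (ran \<alpha>) (ran \<beta>) \<theta> \<and> P \<theta>"
proof -
  have "\<forall>y\<in>ran \<alpha>. \<exists>z\<in>ran \<beta>. v z = Some y"
    unfolding eq by (auto simp: ran_def map_comp_Some_iff)
  then obtain \<theta> where \<theta>: "dom \<theta> = ran \<alpha>" "ran \<theta> \<subseteq> ran \<beta>" "partial_section v \<theta>"
    by (rule partial_section_exists)
  then show ?thesis
    unfolding injection_between_def using P_section[OF v] pinjective_section by blast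
qed

lemma factorization_of_injection:
  assumes \<alpha>: "\<alpha> \<in> carrier (PT_sub P X)" and \<beta>: "\<beta> \<in> carrier (PT_sub P X)"
    and \<theta>: "injection_between (ran \<alpha>) (ran \<beta>) \<theta>" "P \<theta>"
  shows "\<exists>u\<in>carrier (PT_sub P X). \<exists>v\<in>carrier (PT_sub P X). \<alpha> = v \<circ>\<^sub>m (\<beta> \<circ>\<^sub>m u)"
proof -
  have th: "dom \<theta> = ran \<alpha>" "ran \<theta> \<subseteq> ran \<beta>" "pinjective \<theta>"
    using \<theta>(1) by (auto simp: injection_between_def)
  have "\<forall>y\<in>ran \<beta>. \<exists>x\<in>dom \<beta>. \<beta> x = Some y" by (auto simp: ran_def)
  then obtain g where g: "dom g = ran \<beta>" "ran g \<subseteq> dom \<beta>" "partial_section \<beta> g"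
    by (rule partial_section_exists)
  have "\<forall>y\<in>ran \<theta>. \<exists>x\<in>dom \<theta>. \<theta> x = Some y" by (auto simp: ran_def)
  then obtain h where h: "dom h = ran \<theta>" "ran h \<subseteq> dom \<theta>" "partial_section \<theta> h"
    by (rule partial_section_exists)
  let ?u = "g \<circ>\<^sub>m (\<theta> \<circ>\<^sub>m \<alpha>)"
  have "?u \<in> carrier (PT_sub P X)"
  proof -
    have "P ?u"
      using \<alpha> \<beta> \<theta>(2) P_section[OF _ g(3)] P_comp by (auto simp: PT_sub_simps)
    moreover have "dom ?u \<subseteq> X"
      using dom_map_comp_subset[of g "\<theta> \<circ>\<^sub>m \<alpha>"] dom_map_comp_subset[of \<theta> \<alpha>] \<alpha>
      by (auto simp: PT_sub_simps)
    moreover have "ran ?u \<subseteq> X"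
      using ran_map_comp_subset[of g "\<theta> \<circ>\<^sub>m \<alpha>"] g(2) \<beta> by (auto simp: PT_sub_simps)
    ultimately show ?thesis by (simp add: PT_sub_simps)
  qed
  moreover have "h \<in> carrier (PT_sub P X)"
    using \<alpha> \<beta> th h P_section[OF \<theta>(2) h(3)] unfolding PT_sub_simps by blast
  moreover have "\<alpha> = h \<circ>\<^sub>m (\<beta> \<circ>\<^sub>m ?u)"
  proof
    fix x
    show "\<alpha> x = (h \<circ>\<^sub>m (\<beta> \<circ>\<^sub>m ?u)) x"
    proof (cases "\<alpha> x")
      case None
      then show ?thesis by (simp add: map_comp_def)
    next
      case (Some y)
      then obtain z where z: "\<theta> y = Some z" using th(1) by (metis domD ranI)
      then obtain w where w: "g z = Some w" using g(1) th(2) by (metis domD ranI subsetD)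
      obtain y' where y': "h z = Some y'" using h(1) z by (metis domD ranI)
      have "y' = y"
        using partial_sectionD[OF h(3) y'] z th(3) unfolding pinjective_iff by blast
      then show ?thesis
        using Some z w y' partial_sectionD[OF g(3) w] by (simp add: map_comp_def)
    qed
  qed
  ultimately show ?thesis by blast
qed

lemma green_J_iff_injections:
  assumes "\<alpha> \<in> carrier (PT_sub P X)" "\<beta> \<in> carrier (PT_sub P X)"
  shows "green_J (PT_sub P X) \<alpha> \<beta> \<longleftrightarrow>
    (\<exists>\<theta>. injection_between (ran \<alpha>) (ran \<beta>) \<theta> \<and> P \<theta>) \<and>
    (\<exists>\<tau>. injection_between (ran \<beta>) (ran \<alpha>) \<tau> \<and> P \<tau>)"
proof -
  have fac: "(\<exists>u\<in>carrier (PT_sub P X). \<exists>v\<in>carrier (PT_sub P X). f = v \<circ>\<^sub>m (g \<circ>\<^sub>m u)) \<longleftrightarrow>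
      (\<exists>\<theta>. injection_between (ran f) (ran g) \<theta> \<and> P \<theta>)"
    if "f \<in> carrier (PT_sub P X)" "g \<in> carrier (PT_sub P X)" for f g
    using factorization_of_injection[OF that] injection_of_factorization[of _ f g]
    by (metis PT_sub_simps(1))
  show ?thesis
    unfolding green_J_iff_factorization[OF monoid_PT_sub assms] PT_sub_simps(2)
    using fac assms by simp
qed

lemma section_closed_pinjective: "section_closed (\<lambda>f. P f \<and> pinjective f)"
  by unfold_locales
    (auto intro: P_identity P_comp pinjective_identity pinjective_comp pinjective_section
      dest: P_section)

end

section \<open>Order-preserving maps\<close>

lemma order_preserving_on_iff:
  assumes "Y \<subseteq> dom f"
  shows "order_preserving_on Y f \<longleftrightarrow>
    (\<forall>x\<in>Y. \<forall>y\<in>Y. \<forall>a b. f x = Some a \<longrightarrow> f y = Some b \<longrightarrow> x \<le> y \<longrightarrow> a \<le> b)"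
proof -
  have "f x = Some a \<longleftrightarrow> a = the (f x)" if "x \<in> Y" for x a
    using assms that by auto
  then show ?thesis by (auto simp: order_preserving_on_def mono_on_def)
qed

lemma order_preserving_iff:
  "order_preserving f \<longleftrightarrow>
    (\<forall>x y a b. f x = Some a \<longrightarrow> f y = Some b \<longrightarrow> x \<le> y \<longrightarrow> a \<le> b)"
  unfolding order_preserving_def order_preserving_on_iff[OF subset_refl] by blast

interpretation order_preserving: section_closed order_preserving
proof
  show "order_preserving (Some |` X)" for X :: "'a set"
    by (auto simp: order_preserving_iff restrict_map_def split: if_splits)
next
  show "order_preserving (g \<circ>\<^sub>m f)"
    if "order_preserving f" "order_preserving g" for f g :: "'a \<rightharpoonup> 'a"
    using that unfolding order_preserving_iff map_comp_Some_iff by blast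
next
  \<comment> \<open>If \<open>g\<close> inverted some pair strictly, applying \<open>f\<close> would force the two points to be equal.\<close>
  show "order_preserving g"
    if f: "order_preserving f" and s: "partial_section f g" for f g :: "'a \<rightharpoonup> 'a"
    unfolding order_preserving_iff
  proof (intro allI impI)
    fix x y a b
    assume g: "g x = Some a" "g y = Some b" and "x \<le> y"
    have "y \<le> x" if "b \<le> a"
      using f partial_sectionD[OF s g(1)] partial_sectionD[OF s g(2)] that
      unfolding order_preserving_iff by blast
    then show "a \<le> b"
      using \<open>x \<le> y\<close> g linear[of a b] antisym[of x y] by auto
  qed
qed

section \<open>Orientation-preserving maps\<close>

text \<open>Encoding the cut by a predicate and allowing its first piece to be empty makes sections and
  composites easier to treat.\<close>

definition orientation_cut :: "('a::linorder \<Rightarrow> bool) \<Rightarrow> ('a \<rightharpoonup> 'a) \<Rightarrow> bool" where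
  "orientation_cut C f \<longleftrightarrow> (\<forall>x y a b. f x = Some a \<longrightarrow> f y = Some b \<longrightarrow>
     ((C x \<longleftrightarrow> C y) \<longrightarrow> x \<le> y \<longrightarrow> a \<le> b) \<and> (C x \<longrightarrow> \<not> C y \<longrightarrow> x \<le> y \<and> b \<le> a))"

lemma orientation_cutD:
  assumes "orientation_cut C f" "f x = Some a" "f y = Some b"
  shows "C x \<longleftrightarrow> C y \<Longrightarrow> x \<le> y \<Longrightarrow> a \<le> b"
    and "C x \<Longrightarrow> \<not> C y \<Longrightarrow> x \<le> y"
    and "C x \<Longrightarrow> \<not> C y \<Longrightarrow> b \<le> a"
  using assms unfolding orientation_cut_def by blast+

text \<open>A map whose cut has an empty first piece is order-preserving, so that its whole domain can
  serve as first piece instead.\<close>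

lemma orientation_preserving_iff: "orientation_preserving f \<longleftrightarrow> (\<exists>C. orientation_cut C f)"
proof
  assume "orientation_preserving f"
  then consider "f = Map.empty" | Y where "Y \<subseteq> dom f" "order_preserving_on Y f"
    "order_preserving_on (dom f - Y) f"
    "\<forall>a\<in>Y. \<forall>b\<in>dom f - Y. a \<le> b \<and> the (f a) \<ge> the (f b)"
    unfolding orientation_preserving_def by blast
  then show "\<exists>C. orientation_cut C f"
  proof cases
    case 2
    note mono = 2(2)[unfolded order_preserving_on_iff[OF 2(1)]]
      2(3)[unfolded order_preserving_on_iff[OF Diff_subset]]
    have "orientation_cut (\<lambda>x. x \<in> Y) f"
      unfolding orientation_cut_def
    proof (intro allI impI)
      fix x y a b
      assume f: "f x = Some a" "f y = Some b"
      have "a \<le> b" if "x \<in> Y" "y \<in> Y" "x \<le> y"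
        using mono(1) f that by blast
      moreover have "a \<le> b" if "x \<notin> Y" "y \<notin> Y" "x \<le> y"
        using mono(2) f that by blast
      moreover have "x \<le> y \<and> b \<le> a" if "x \<in> Y" "y \<notin> Y"
        using bspec[OF bspec[OF 2(4) that(1)], of y] f that(2) by auto
      ultimately show "((x \<in> Y \<longleftrightarrow> y \<in> Y) \<longrightarrow> x \<le> y \<longrightarrow> a \<le> b) \<and>
          (x \<in> Y \<longrightarrow> y \<notin> Y \<longrightarrow> x \<le> y \<and> b \<le> a)"
        by blast
    qed
    then show ?thesis by (rule exI[where x = "\<lambda>x. x \<in> Y"])
  qed (simp add: orientation_cut_def)
next
  assume "\<exists>C. orientation_cut C f"
  then obtain C where C: "orientation_cut C f" ..
  show "orientation_preserving f"
  proof (cases "\<exists>x. x \<in> dom f \<and> C x")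
    case True
    let ?Y = "{x \<in> dom f. C x}"
    have "?Y \<noteq> {}" using True by blast
    moreover have "?Y \<subseteq> dom f" by blast
    moreover have "order_preserving_on ?Y f"
      unfolding order_preserving_on_iff[OF Collect_restrict]
      using orientation_cutD(1)[OF C] by blast
    moreover have "order_preserving_on (dom f - ?Y) f"
      unfolding order_preserving_on_iff[OF Diff_subset]
      using orientation_cutD(1)[OF C] by blast
    moreover have "\<forall>a\<in>?Y. \<forall>b\<in>dom f - ?Y. a \<le> b \<and> the (f a) \<ge> the (f b)"
    proof (intro ballI)
      fix a b assume "a \<in> ?Y" "b \<in> dom f - ?Y"
      moreover then obtain u v where "f a = Some u" "f b = Some v" by blast
      ultimately show "a \<le> b \<and> the (f a) \<ge> the (f b)"
        using orientation_cutD(2,3)[OF C, of a u b v] by auto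
    qed
    ultimately show ?thesis
      unfolding orientation_preserving_def by (intro disjI2 exI[of _ ?Y] conjI)
  next
    case False
    then have "order_preserving_on (dom f) f"
      unfolding order_preserving_on_iff[OF subset_refl]
      using orientation_cutD(1)[OF C] by blast
    then have "f = Map.empty \<or> dom f \<noteq> {} \<and> dom f \<subseteq> dom f \<and> order_preserving_on (dom f) f \<and>
        order_preserving_on (dom f - dom f) f \<and>
        (\<forall>a\<in>dom f. \<forall>b\<in>dom f - dom f. a \<le> b \<and> the (f a) \<ge> the (f b))"
      by (simp add: order_preserving_on_def mono_on_def)
    then show ?thesis
      unfolding orientation_preserving_def by (elim disjE) (rule disjI1, assumption, rule disjI2, rule exI)
  qed
qed

text \<open>Cutting the domain of \<open>f\<close> at its own cut and at the preimage of the cut of \<open>g\<close> gives four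
  consecutive pieces. The first and the last cannot both be non-empty: the values of \<open>f\<close> on the
  last piece would lie in the upper part for \<open>g\<close> and yet below those on the first piece, which
  lie in the lower part. With at most three pieces left, one of the two outer boundaries
  is a cut for the composite.\<close>

lemma orientation_preserving_comp:
  fixes f g :: "'a::linorder \<rightharpoonup> 'a"
  assumes "orientation_preserving f" "orientation_preserving g"
  shows "orientation_preserving (g \<circ>\<^sub>m f)"
proof -
  obtain C where C: "orientation_cut C f"
    using assms(1) unfolding orientation_preserving_iff ..
  obtain D where D: "orientation_cut D g"
    using assms(2) unfolding orientation_preserving_iff ..
  let ?last = "\<lambda>x. \<exists>z c. f x = Some z \<and> g z = Some c \<and> \<not> C x \<and> \<not> D z"
  \<comment> \<open>The cut follows the first piece if the last one is empty, and precedes the last piece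
    otherwise.\<close>
  define E where
    "E x = (if \<exists>x. ?last x then \<not> ?last x else C x \<and> D (the (f x)))" for x
  have "orientation_cut E (g \<circ>\<^sub>m f)"
    unfolding orientation_cut_def map_comp_Some_iff
  proof (intro allI impI)
    fix x y a b
    assume "\<exists>z. f x = Some z \<and> g z = Some a" "\<exists>w. f y = Some w \<and> g w = Some b"
    then obtain z w where z: "f x = Some z" "g z = Some a" and w: "f y = Some w" "g w = Some b"
      by blast
    have eq: "x = y \<Longrightarrow> z = w" "x = y \<Longrightarrow> C x = C y" "z = w \<Longrightarrow> a \<le> b \<and> b \<le> a" "z = w \<Longrightarrow> D z = D w"
      using z w by auto
    note facts = orientation_cutD[OF C z(1) w(1)] orientation_cutD[OF C w(1) z(1)]
      orientation_cutD[OF D z(2) w(2)] orientation_cutD[OF D w(2) z(2)]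
      linear[of x y] antisym[of x y] linear[of z w] antisym[of z w] eq
    show "((E x \<longleftrightarrow> E y) \<longrightarrow> x \<le> y \<longrightarrow> a \<le> b) \<and> (E x \<longrightarrow> \<not> E y \<longrightarrow> x \<le> y \<and> b \<le> a)"
    proof (cases "\<exists>x. ?last x")
      case True
      then obtain l k m where l: "f l = Some k" "g k = Some m" "\<not> C l" "\<not> D k" by blast
      have first: "\<not> (C p \<and> D q)" if "f p = Some q" "g q = Some r" for p q r
      proof
        assume "C p \<and> D q"
        then have "k \<le> q" "q \<le> k"
          using orientation_cutD(3)[OF C that(1) l(1)] orientation_cutD(2)[OF D that(2) l(2)] l(3,4)
          by auto
        then show False using \<open>C p \<and> D q\<close> l(4) by simp
      qed
      have "E x \<longleftrightarrow> C x \<or> D z" "E y \<longleftrightarrow> C y \<or> D w"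
        using True z w by (auto simp: E_def)
      then show ?thesis
        using facts first[OF z] first[OF w] by sat
    next
      case False
      then have "C x \<or> D z" "C y \<or> D w" using z w by blast+
      moreover have "E x \<longleftrightarrow> C x \<and> D z" "E y \<longleftrightarrow> C y \<and> D w"
        unfolding E_def if_not_P[OF False] using z w by simp_all
      ultimately show ?thesis
        using facts by sat
    qed
  qed
  then show ?thesis unfolding orientation_preserving_iff by (rule exI[where x = E])
qed

interpretation orientation_preserving: section_closed orientation_preserving
proof
  show "orientation_preserving (Some |` X)" for X :: "'a set"
    unfolding orientation_preserving_iff
    by (rule exI[of _ "\<lambda>_. True"]) (auto simp: orientation_cut_def restrict_map_def split: if_splits)
next
  show "orientation_preserving (g \<circ>\<^sub>m f)"
    if "orientation_preserving f" "orientation_preserving g" for f g :: "'a \<rightharpoonup> 'a"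
    using that by (rule orientation_preserving_comp)
next
  fix f g :: "'a \<rightharpoonup> 'a"
  assume "orientation_preserving f" and s: "partial_section f g"
  then obtain C where C: "orientation_cut C f"
    unfolding orientation_preserving_iff by blast
  \<comment> \<open>The values on the second piece of \<open>f\<close> are the small ones, so they form the first piece
    of the section.\<close>
  have "orientation_cut (\<lambda>y. \<not> C (the (g y))) g"
    unfolding orientation_cut_def
  proof (intro allI impI)
    fix x y a b
    assume g: "g x = Some a" "g y = Some b"
    note f = partial_sectionD[OF s g(1)] partial_sectionD[OF s g(2)]
    have "a = b \<Longrightarrow> x = y" using f by auto
    then show "((\<not> C (the (g x)) \<longleftrightarrow> \<not> C (the (g y))) \<longrightarrow> x \<le> y \<longrightarrow> a \<le> b) \<and>
       (\<not> C (the (g x)) \<longrightarrow> \<not> \<not> C (the (g y)) \<longrightarrow> x \<le> y \<and> b \<le> a)"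
      unfolding g option.sel
      using orientation_cutD[OF C f(1) f(2)] orientation_cutD[OF C f(2) f(1)]
        linear[of a b] antisym[of x y] g
      by auto
  qed
  then show "orientation_preserving g"
    unfolding orientation_preserving_iff by blast
qed

section \<open>The characterization of Green's J relation\<close>

lemma PT_sub_eqs:
  "PO X = PT_sub order_preserving X"
  "POI X = PT_sub (\<lambda>f. order_preserving f \<and> pinjective f) X"
  "POP X = PT_sub orientation_preserving X"
  "POPI X = PT_sub (\<lambda>f. orientation_preserving f \<and> pinjective f) X"
  by (auto simp: PO_def POI_def POP_def POPI_def PT_sub_def)

text \<open>Passing from \<open>P\<close> to the injective maps in \<open>P\<close> changes the monoid but not the condition on
  images, which speaks of injections only.\<close>

lemma (in section_closed) green_J_iff_injections_pinjective:
  assumes "\<alpha> \<in> carrier (PT_sub (\<lambda>f. P f \<and> pinjective f) X)"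
    and "\<beta> \<in> carrier (PT_sub (\<lambda>f. P f \<and> pinjective f) X)"
  shows "green_J (PT_sub (\<lambda>f. P f \<and> pinjective f) X) \<alpha> \<beta> \<longleftrightarrow>
    (\<exists>\<theta>. injection_between (ran \<alpha>) (ran \<beta>) \<theta> \<and> P \<theta>) \<and>
    (\<exists>\<tau>. injection_between (ran \<beta>) (ran \<alpha>) \<tau> \<and> P \<tau>)"
  unfolding section_closed.green_J_iff_injections[OF section_closed_pinjective assms]
  by (auto simp: injection_between_def)

theorem proposition4p12:
  fixes X :: "'a::linorder set"
  shows "(\<forall>S\<in>{PO X, POI X}. \<forall>\<alpha>\<in>carrier S. \<forall>\<beta>\<in>carrier S.
            green_J S \<alpha> \<beta> \<longleftrightarrow>
              (\<exists>\<theta>. injection_between (ran \<alpha>) (ran \<beta>) \<theta> \<and> order_preserving \<theta>) \<and>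
              (\<exists>\<tau>. injection_between (ran \<beta>) (ran \<alpha>) \<tau> \<and> order_preserving \<tau>)) \<and>
         (\<forall>S\<in>{POP X, POPI X}. \<forall>\<alpha>\<in>carrier S. \<forall>\<beta>\<in>carrier S.
            green_J S \<alpha> \<beta> \<longleftrightarrow>
              (\<exists>\<theta>. injection_between (ran \<alpha>) (ran \<beta>) \<theta> \<and> orientation_preserving \<theta>) \<and>
              (\<exists>\<tau>. injection_between (ran \<beta>) (ran \<alpha>) \<tau> \<and> orientation_preserving \<tau>))"
  unfolding PT_sub_eqs
  using order_preserving.green_J_iff_injections[of _ X]
    order_preserving.green_J_iff_injections_pinjective[of _ X]
    orientation_preserving.green_J_iff_injections[of _ X]
    orientation_preserving.green_J_iff_injections_pinjective[of _ X]
  by simp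

end
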